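(* For a three-dimensional rotating black hole with metric functions $f_1,f_2,f_3$ and pole-skipping data $E_n(k^l)$, $n=1,2$ (defined in the context), put $f_{aj}=f_a^{(j)}(1)$ and assume $E_1(k^2)-m^2\neq0$. Then the first and second derivatives of the metric functions at the horizon are determined by the data as follows: $$f_{11}=\frac{2\mathfrak w_1^2}{E_1(k^2)-m^2},\qquad f_{21}=2\big(m^2-E_1(k^2)\big),\qquad f_{31}=\frac{E_1(k)\,\mathfrak w_1}{m^2-E_1(k^2)},$$ $$f_{12}=-\frac{\mathfrak w_1^2}{2(E_1(k^2)-m^2)^3}\Big[m^4+\big(3E_2(k^2)-9E_1(k)^2-12E_1(k^2)\big)m^2+12E_1(k^2)^2+12E_1(k)^2E_1(k^2)-4E_1(k^2)E_2(k^2)+E_2(k^4)\Big],$$ $$f_{22}=-\frac{1}{2(E_1(k^2)-m^2)}\Big[3m^4+\big(E_2(k^2)-3E_1(k)^2-20E_1(k^2)\big)m^2+3E_2(k^4)+12E_1(k)^2E_1(k^2)+20E_1(k^2)^2-4E_1(k^2)E_2(k^2)\Big],$$ $$f_{32}=\frac{\mathfrak w_1}{4(E_1(k^2)-m^2)^3}\Big[\big(3E_1(k)^3-12E_1(k)E_1(k^2)-E_1(k)E_2(k^2)+2E_2(k^3)\big)m^2+E_1(k)m^4+12E_1(k)E_1(k^2)^2-2E_1(k^2)E_2(k^3)+E_1(k)E_2(k^4)\Big].$$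
   Context: Metric: $ds^2=-\frac{f_1(z)}{z^2}dt^2+\frac{dz^2}{z^2f_2(z)}+\frac1{z^2}(d\varphi-f_3(z)dt)^2$, horizon at $z=1$, $f_a$ analytic near $z=1$, $f_1(1)=f_2(1)=0$, $f_3(1)=\Omega_H$, and $f_1'(1)f_2'(1)=(4\pi T)^2$ with $T>0$ the Hawking temperature. A free scalar of mass $m$, $\Phi=e^{-i\omega t+ik\varphi}\psi(z)$, satisfies $A\psi''+B\psi'+C\psi=0$ with $A=f_1f_2$, $B=\frac12(f_1f_2)'-\frac{f_1f_2}{z}$, $C=(\omega-kf_3)^2-f_1\frac{k^2z^2+m^2}{z^2}$. Write $A_j,B_j,C_j$ for the coefficients of $(z-1)^j$ in $A,B,C$ (zero for $j<0$). Put $\mathfrak w=\omega-k\Omega_H$, $\rho=-i\mathfrak w/(4\pi T)$ and $$M_{KS}=A_{K-S+3}(\rho+S-1)(\rho+S-2)+B_{K-S+2}(\rho+S-1)+C_{K-S+1},$$ the coefficient of $\phi_{S-1}$ at order $(z-1)^{\rho+K}$ when $\psi=(z-1)^\rho\sum_j\phi_j(z-1)^j$ is inserted. At the pole-skipping frequency $\mathfrak w_n=-2\pi iTn$ (so $\rho=-n/2$, $\omega-kf_3=\mathfrak w_n-k(f_3-\Omega_H)$), $\det(M_{KS})_{1\le K,S\le n}$ is a polynomial in $k$ of degree $2n$; its roots (with multiplicity) are the order-$n$ pole-skipping momenta, and $E_n(k^l)$ denotes the elementary symmetric polynomial of degree $l$ in these $2n$ roots. *)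

theory Defs
  imports
    "HOL-Complex_Analysis.Complex_Analysis"
    "Jordan_Normal_Form.Determinant"
begin

text \<open>
  A metric function is real-valued and real-analytic near \<open>z = 1\<close>. It is represented by its
  holomorphic extension to a complex neighbourhood of \<open>1\<close>: a function that is analytic there and
  takes real values at the real points near \<open>1\<close>.
\<close>

definition metric_function :: "(complex \<Rightarrow> complex) \<Rightarrow> bool" where
  "metric_function f \<longleftrightarrow>
     f analytic_on {1} \<and> (\<forall>\<^sub>F x in nhds (1::real). f (complex_of_real x) \<in> \<real>)"

text \<open>
  Coefficient functions of the radial equation \<open>A \<psi>'' + B \<psi>' + C \<psi> = 0\<close> of the scalar
  \<open>exp (- \<i> \<omega> t + \<i> k \<phi>) \<psi> z\<close> in the metric
  \<open>- (f1 z / z\<^sup>2) dt\<^sup>2 + dz\<^sup>2 / (z\<^sup>2 f2 z) + (1 / z\<^sup>2) (d\<phi> - f3 z dt)\<^sup>2\<close>.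
\<close>

definition radial_A :: "(complex \<Rightarrow> complex) \<Rightarrow> (complex \<Rightarrow> complex) \<Rightarrow> complex \<Rightarrow> complex" where
  "radial_A f1 f2 z = f1 z * f2 z"

definition radial_B :: "(complex \<Rightarrow> complex) \<Rightarrow> (complex \<Rightarrow> complex) \<Rightarrow> complex \<Rightarrow> complex" where
  "radial_B f1 f2 z = 1 / 2 * deriv (\<lambda>z. f1 z * f2 z) z - f1 z * f2 z / z"

definition radial_C ::
  "(complex \<Rightarrow> complex) \<Rightarrow> (complex \<Rightarrow> complex) \<Rightarrow> complex \<Rightarrow> complex \<Rightarrow> complex
    \<Rightarrow> complex \<Rightarrow> complex" where
  "radial_C f1 f3 m \<omega> k z =
     (\<omega> - k * f3 z)\<^sup>2 - f1 z * ((k\<^sup>2 * z\<^sup>2 + m\<^sup>2) / z\<^sup>2)"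

definition horizon_coeff :: "(complex \<Rightarrow> complex) \<Rightarrow> int \<Rightarrow> complex" where
  "horizon_coeff g j = (if j < 0 then 0 else fps_nth (fps_expansion g 1) (nat j))"

definition corotating_freq :: "real \<Rightarrow> complex \<Rightarrow> complex \<Rightarrow> complex" where
  "corotating_freq \<Omega> \<omega> k = \<omega> - k * complex_of_real \<Omega>"

definition horizon_exponent :: "real \<Rightarrow> real \<Rightarrow> complex \<Rightarrow> complex \<Rightarrow> complex" where
  "horizon_exponent T \<Omega> \<omega> k =
     - \<i> * corotating_freq \<Omega> \<omega> k / complex_of_real (4 * pi * T)"

text \<open>The indices \<open>K\<close> and \<open>S\<close> start at \<open>1\<close>.\<close>

definition frobenius_entry ::
  "(complex \<Rightarrow> complex) \<Rightarrow> (complex \<Rightarrow> complex) \<Rightarrow> (complex \<Rightarrow> complex)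
    \<Rightarrow> complex \<Rightarrow> real \<Rightarrow> real \<Rightarrow> complex \<Rightarrow> complex \<Rightarrow> nat \<Rightarrow> nat \<Rightarrow> complex" where
  "frobenius_entry f1 f2 f3 m T \<Omega> \<omega> k K S =
     (let \<rho> = horizon_exponent T \<Omega> \<omega> k; d = int K - int S in
        horizon_coeff (radial_A f1 f2) (d + 3) * (\<rho> + of_nat S - 1) * (\<rho> + of_nat S - 2)
      + horizon_coeff (radial_B f1 f2) (d + 2) * (\<rho> + of_nat S - 1)
      + horizon_coeff (radial_C f1 f3 m \<omega> k) (d + 1))"

definition pole_skipping_freq :: "real \<Rightarrow> nat \<Rightarrow> complex" where
  "pole_skipping_freq T n = - 2 * complex_of_real pi * \<i> * complex_of_real T * of_nat n"

text \<open>
  The pole-skipping frequency is the corotating one, so the frequency itself is shifted by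
  \<open>k * \<Omega>\<close> and depends on \<open>k\<close>.
\<close>

definition pole_skipping_det ::
  "(complex \<Rightarrow> complex) \<Rightarrow> (complex \<Rightarrow> complex) \<Rightarrow> (complex \<Rightarrow> complex)
    \<Rightarrow> complex \<Rightarrow> real \<Rightarrow> real \<Rightarrow> nat \<Rightarrow> complex \<Rightarrow> complex" where
  "pole_skipping_det f1 f2 f3 m T \<Omega> n k =
     Determinant.det (Matrix.mat n n (\<lambda>(i, j).
       frobenius_entry f1 f2 f3 m T \<Omega>
         (pole_skipping_freq T n + k * complex_of_real \<Omega>) k (i + 1) (j + 1)))"

definition pole_skipping_poly ::
  "(complex \<Rightarrow> complex) \<Rightarrow> (complex \<Rightarrow> complex) \<Rightarrow> (complex \<Rightarrow> complex)
    \<Rightarrow> complex \<Rightarrow> real \<Rightarrow> real \<Rightarrow> nat \<Rightarrow> complex poly" where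
  "pole_skipping_poly f1 f2 f3 m T \<Omega> n =
     (THE p. \<forall>k. poly p k = pole_skipping_det f1 f2 f3 m T \<Omega> n k)"

definition pole_skipping_momenta ::
  "(complex \<Rightarrow> complex) \<Rightarrow> (complex \<Rightarrow> complex) \<Rightarrow> (complex \<Rightarrow> complex)
    \<Rightarrow> complex \<Rightarrow> real \<Rightarrow> real \<Rightarrow> nat \<Rightarrow> complex multiset" where
  "pole_skipping_momenta f1 f2 f3 m T \<Omega> n = proots (pole_skipping_poly f1 f2 f3 m T \<Omega> n)"

text \<open>
  Elementary symmetric polynomial of degree \<open>l\<close> in the elements of a multiset. Repeated elements
  are told apart by a second component, so that the sum ranges over all choices of \<open>l\<close> of them.
\<close>

definition elem_sym :: "nat \<Rightarrow> 'a :: comm_ring_1 multiset \<Rightarrow> 'a" where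
  "elem_sym l X =
     (\<Sum>I | I \<subseteq> (SIGMA x : set_mset X. {..<count X x}) \<and> card I = l. \<Prod>(x, i)\<in>I. x)"

text \<open>The pole-skipping data \<open>E\<^sub>n(k\<^sup>l)\<close>.\<close>

definition pole_skipping_data ::
  "(complex \<Rightarrow> complex) \<Rightarrow> (complex \<Rightarrow> complex) \<Rightarrow> (complex \<Rightarrow> complex)
    \<Rightarrow> complex \<Rightarrow> real \<Rightarrow> real \<Rightarrow> nat \<Rightarrow> nat \<Rightarrow> complex" where
  "pole_skipping_data f1 f2 f3 m T \<Omega> n l =
     elem_sym l (pole_skipping_momenta f1 f2 f3 m T \<Omega> n)"

end

theory Submission
  imports Defs "HOL-Computational_Algebra.Fundamental_Theorem_Algebra"
begin

text \<open>
  Write \<open>a\<^sub>j, b\<^sub>j, c\<^sub>j\<close> for the Taylor coefficients of \<open>f\<^sub>1, f\<^sub>2, f\<^sub>3\<close> at the horizon; the temperature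
  condition reads \<open>a\<^sub>1 b\<^sub>1 = - 4 w\<^sup>2\<close>. The determinant of order 1 is a quadratic in \<open>k\<close>, so by Vieta
  its roots fix \<open>a\<^sub>1\<close> and \<open>c\<^sub>1\<close>, hence \<open>b\<^sub>1\<close>. The determinant of order 2 is a quartic: at
  \<open>\<rho> = - 1\<close> the third-order coefficient \<open>A\<^sub>4\<close> drops out, because it enters the lower left entry as
  \<open>2 A\<^sub>4 - B\<^sub>3\<close> and \<open>B\<^sub>3 = 2 A\<^sub>4 - A\<^sub>3 + A\<^sub>2\<close>. The remaining unknowns \<open>a\<^sub>2, b\<^sub>2, c\<^sub>2\<close> enter its
  coefficients linearly, and this linear system is solved by the stated formulas.
\<close>


section \<open>Vieta's formulas for multisets of roots\<close>

text \<open>Label repeated elements so that the product runs over a set \<open>S\<close> of pairs,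
  then expand it: a subset \<open>I\<close> collects the factors contributing their constant term
  and yields a monomial of degree \<open>card S - card I\<close>.\<close>

lemma coeff_prod_mset_linear:
  fixes X :: "'a :: idom multiset"
  assumes "l \<le> size X"
  shows "poly.coeff (\<Prod>x\<in>#X. [:- x, 1:]) (size X - l) = (- 1) ^ l * elem_sym l X"
proof -
  define S where "S = (SIGMA x : set_mset X. {..<count X x})"
  have fin: "finite S" and card: "card S = size X"
    by (auto simp: S_def size_multiset_overloaded_eq)
  have summand: "(\<Prod>y\<in>I. [:- fst y:]) * (\<Prod>y\<in>S - I. [:0, 1:])
      = Polynomial.monom ((- 1) ^ card I * (\<Prod>y\<in>I. fst y)) (card S - card I)"
    if "I \<subseteq> S" for I
  proof -
    have "(\<Prod>y\<in>I. [:- fst y:]) = [:(- 1) ^ card I * (\<Prod>y\<in>I. fst y):]"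
      using finite_subset[OF that fin]
      by (induction I rule: finite_induct) (auto simp: algebra_simps)
    moreover have "card (S - I) = card S - card I"
      using that fin by (simp add: card_Diff_subset finite_subset)
    ultimately show ?thesis
      by (simp add: monom_altdef)
  qed
  have "(\<Prod>x\<in>#X. [:- x, 1:]) = (\<Prod>x\<in>set_mset X. \<Prod>i<count X x. [:- x, 1:])"
    by (simp add: image_prod_mset_multiplicity)
  also have "\<dots> = (\<Prod>(x, i)\<in>S. [:- x, 1:])"
    unfolding S_def by (rule prod.Sigma) auto
  also have "\<dots> = (\<Prod>y\<in>S. [:- fst y, 1:])"
    by (simp add: case_prod_unfold)
  also have "\<dots> = (\<Prod>y\<in>S. [:- fst y:] + [:0, 1:])"
    by simp
  also have "\<dots> = (\<Sum>I\<in>Pow S. (\<Prod>y\<in>I. [:- fst y:]) * (\<Prod>y\<in>S - I. [:0, 1:]))"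
    by (rule prod_add[OF fin])
  also have "\<dots> = (\<Sum>I\<in>Pow S.
      Polynomial.monom ((- 1) ^ card I * (\<Prod>y\<in>I. fst y)) (card S - card I))"
    by (intro sum.cong refl summand) auto
  finally have "poly.coeff (\<Prod>x\<in>#X. [:- x, 1:]) (size X - l)
      = (\<Sum>I\<in>Pow S. if card S - card I = card S - l
                      then (- 1) ^ card I * (\<Prod>y\<in>I. fst y) else 0)"
    by (simp add: coeff_sum card)
  also have "\<dots> = (\<Sum>I | I \<subseteq> S \<and> card I = l. (- 1) ^ card I * (\<Prod>y\<in>I. fst y))"
  proof (intro sum.mono_neutral_cong_right)
    \<comment> \<open>Subtraction on naturals truncates; equality of the two differences forces
      \<open>card I = l\<close> only because neither \<open>card I\<close> nor \<open>l\<close>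
      exceeds \<open>card S\<close>.\<close>
    have "card S - card I \<noteq> card S - l" if "I \<subseteq> S" "card I \<noteq> l" for I
      using card_mono[OF fin that(1)] that(2) assms card by linarith
    then show "\<forall>I\<in>Pow S - {I. I \<subseteq> S \<and> card I = l}.
      (if card S - card I = card S - l then (- 1) ^ card I * (\<Prod>y\<in>I. fst y) else 0) = 0"
      by simp
  qed (use fin in auto)
  also have "\<dots> = (- 1) ^ l * elem_sym l X"
    by (simp add: elem_sym_def S_def case_prod_unfold sum_distrib_left)
  finally show ?thesis .
qed

lemma elem_sym_proots:
  fixes p :: "complex poly"
  assumes "l \<le> Polynomial.degree p"
  shows "poly.coeff p (Polynomial.degree p - l) = lead_coeff p * (- 1) ^ l * elem_sym l (proots p)"
  using coeff_prod_mset_linear[of l "proots p"] assms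
    arg_cong[OF complex_poly_decompose_multiset[of p],
      of "\<lambda>q. poly.coeff q (Polynomial.degree p - l)"]
  by (simp add: size_proots_complex mult.assoc)

section \<open>Pole-skipping data as coefficient ratios\<close>

text \<open>A complex polynomial is determined by its values, so the \<open>THE\<close> in the
  definition is resolved by any polynomial that represents the determinant.\<close>

lemma pole_skipping_poly_eqI:
  assumes "\<And>k. pole_skipping_det f1 f2 f3 m T \<Omega> n k = poly p k"
  shows "pole_skipping_poly f1 f2 f3 m T \<Omega> n = p"
  unfolding pole_skipping_poly_def assms
  by (intro the_equality) (auto simp: poly_eq_poly_eq_iff[symmetric] fun_eq_iff)

lemma pole_skipping_data_eq:
  assumes det: "\<And>k. pole_skipping_det f1 f2 f3 m T \<Omega> n k = poly p k"
    and "p \<noteq> 0" "l \<le> Polynomial.degree p"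
  shows "pole_skipping_data f1 f2 f3 m T \<Omega> n l
    = (- 1) ^ l * poly.coeff p (Polynomial.degree p - l) / lead_coeff p"
  using elem_sym_proots[of l p] assms(2,3)
  by (simp add: pole_skipping_data_def pole_skipping_momenta_def pole_skipping_poly_eqI[OF det])

lemma pole_skipping_data_quadratic:
  assumes "\<And>k. pole_skipping_det f1 f2 f3 m T \<Omega> n k = poly [:p0, p1, p2:] k" "p2 \<noteq> 0"
  shows "pole_skipping_data f1 f2 f3 m T \<Omega> n 1 = - p1 / p2"
    and "pole_skipping_data f1 f2 f3 m T \<Omega> n 2 = p0 / p2"
  using assms(2) by (subst pole_skipping_data_eq[OF assms(1)]; simp)+

lemma pole_skipping_data_quartic:
  assumes "\<And>k. pole_skipping_det f1 f2 f3 m T \<Omega> n k = poly [:p0, p1, p2, p3, p4:] k" "p4 \<noteq> 0"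
  shows "pole_skipping_data f1 f2 f3 m T \<Omega> n 2 = p2 / p4"
    and "pole_skipping_data f1 f2 f3 m T \<Omega> n 3 = - p1 / p4"
    and "pole_skipping_data f1 f2 f3 m T \<Omega> n 4 = p0 / p4"
  using assms(2) by (subst pole_skipping_data_eq[OF assms(1)]; simp add: numeral_eq_Suc)+

section \<open>Taylor coefficients of the radial equation at the horizon\<close>

text \<open>Uniqueness of power series: any series found for \<open>g (1 + x)\<close> by the
  expansion rules is \<open>fps_expansion g 1\<close>, once the higher derivatives at 1 are shifted
  to 0.\<close>

lemma horizon_coeff_eq:
  assumes "(\<lambda>x. g (1 + x)) has_fps_expansion G"
  shows "horizon_coeff g j = (if j < 0 then 0 else fps_nth G (nat j))"
proof -
  have "fps_expansion g 1 = G"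
    using fps_nth_fps_expansion[OF assms]
    by (auto simp: fps_eq_iff fps_expansion_def higher_deriv_shift_0'[of 1 _ g] o_def)
  then show ?thesis
    by (simp add: horizon_coeff_def)
qed

lemma metric_function_has_fps_expansion:
  assumes "metric_function f"
  shows "(\<lambda>x. f (1 + x)) has_fps_expansion fps_expansion f 1"
  using assms by (auto simp: metric_function_def intro: analytic_at_imp_has_fps_expansion)

lemma radial_A_has_fps_expansion:
  assumes "(\<lambda>x. f1 (1 + x)) has_fps_expansion F1" "(\<lambda>x. f2 (1 + x)) has_fps_expansion F2"
  shows "(\<lambda>x. radial_A f1 f2 (1 + x)) has_fps_expansion F1 * F2"
  unfolding radial_A_def by (intro fps_expansion_intros assms)

lemma radial_B_has_fps_expansion:
  assumes "(\<lambda>x. f1 (1 + x)) has_fps_expansion F1" "(\<lambda>x. f2 (1 + x)) has_fps_expansion F2"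
  shows "(\<lambda>x. radial_B f1 f2 (1 + x)) has_fps_expansion
    fps_const (1 / 2) * fps_deriv (F1 * F2) - F1 * F2 * inverse (1 + fps_X)"
proof -
  have shift: "deriv (\<lambda>z. f1 z * f2 z) (1 + x) = deriv (\<lambda>x. f1 (1 + x) * f2 (1 + x)) x" for x
    by (subst (1 2) deriv_shift_0) (simp add: o_def add.assoc)
  show ?thesis
    unfolding radial_B_def shift divide_inverse
    by (intro fps_expansion_intros assms) auto
qed

lemma radial_C_has_fps_expansion:
  assumes "(\<lambda>x. f1 (1 + x)) has_fps_expansion F1" "(\<lambda>x. f3 (1 + x)) has_fps_expansion F3"
  shows "(\<lambda>x. radial_C f1 f3 m \<omega> k (1 + x)) has_fps_expansion
    (fps_const \<omega> - fps_const k * F3)\<^sup>2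
      - F1 * (fps_const (k\<^sup>2) + fps_const (m\<^sup>2) * (inverse (1 + fps_X))\<^sup>2)"
proof -
  have "(1 + fps_X :: complex fps) * inverse (1 + fps_X) = 1"
    by (rule inverse_mult_eq_1') simp
  \<comment> \<open>The series is stated with k^2 + m^2/z^2, whose coefficients are easy to read
    off; the definition has the single quotient (k^2 z^2 + m^2)/z^2.\<close>
  then have eq: "fps_const (k\<^sup>2) + fps_const (m\<^sup>2) * (inverse (1 + fps_X))\<^sup>2
      = (fps_const (k\<^sup>2) * (1 + fps_X)\<^sup>2 + fps_const (m\<^sup>2)) * (inverse (1 + fps_X))\<^sup>2"
    by (simp add: distrib_right mult.assoc flip: power_mult_distrib)
  show ?thesis
    unfolding radial_C_def divide_inverse power_inverse[symmetric] eq
    by (intro fps_expansion_intros assms) auto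
qed

lemma det_mat_2:
  "Determinant.det (Matrix.mat 2 2 f) = f (0, 0) * f (1, 1) - f (0, 1) * f (1, 0)"
  for f :: "nat \<times> nat \<Rightarrow> 'a :: comm_ring_1"
proof -
  have "Determinant.det (Matrix.mat 2 2 f)
      = (\<Sum>j<2. Matrix.mat 2 2 f $$ (0, j) * cofactor (Matrix.mat 2 2 f) 0 j)"
    by (rule laplace_expansion_row) auto
  then show ?thesis
    by (simp add: numeral_2_eq_2 cofactor_def det_single mat_delete_def)
qed

lemma horizon_coeff_radial_A:
  assumes "(\<lambda>x. f1 (1 + x)) has_fps_expansion F1" "(\<lambda>x. f2 (1 + x)) has_fps_expansion F2"
    and "fps_nth F1 0 = 0" "fps_nth F2 0 = 0"
  shows "horizon_coeff (radial_A f1 f2) 2 = fps_nth F1 1 * fps_nth F2 1"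
    and "horizon_coeff (radial_A f1 f2) 3 = fps_nth F1 1 * fps_nth F2 2 + fps_nth F1 2 * fps_nth F2 1"
  using assms(3,4)
  by (simp_all add: horizon_coeff_eq[OF radial_A_has_fps_expansion[OF assms(1,2)]]
      fps_mult_nth sum.atLeast_Suc_atMost numeral_eq_Suc)

text \<open>The product of the metric functions starts at order 2 and 1/z is the alternating
  geometric series, so B_j = (j+1)/2 A_{j+1} - A_j + A_{j-1} - ... Leaving \<open>A 4\<close>
  unevaluated lets it cancel later.\<close>

lemma horizon_coeff_radial_B:
  assumes "(\<lambda>x. f1 (1 + x)) has_fps_expansion F1" "(\<lambda>x. f2 (1 + x)) has_fps_expansion F2"
    and "fps_nth F1 0 = 0" "fps_nth F2 0 = 0"
  defines "A \<equiv> horizon_coeff (radial_A f1 f2)"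
  shows "horizon_coeff (radial_B f1 f2) 1 = A 2"
    and "horizon_coeff (radial_B f1 f2) 2 = 3 / 2 * A 3 - A 2"
    and "horizon_coeff (radial_B f1 f2) 3 = 2 * A 4 - A 3 + A 2"
proof -
  define P where "P = F1 * F2"
  have P: "fps_nth P 0 = 0" "fps_nth P (Suc 0) = 0"
    using assms(3,4) by (simp_all add: P_def fps_mult_nth)
  have inv: "inverse (1 + fps_X :: complex fps) = Abs_fps (\<lambda>n. (- 1) ^ n)"
    using fps_inverse_fps_X_plus1 by (simp add: add.commute)
  note B = horizon_coeff_eq[OF radial_B_has_fps_expansion[OF assms(1,2)], folded P_def]
    and A = horizon_coeff_eq[OF radial_A_has_fps_expansion[OF assms(1,2)], folded P_def]
  show "horizon_coeff (radial_B f1 f2) 1 = A 2"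
    and "horizon_coeff (radial_B f1 f2) 2 = 3 / 2 * A 3 - A 2"
    and "horizon_coeff (radial_B f1 f2) 3 = 2 * A 4 - A 3 + A 2"
    unfolding A_def B A inv
    using P by (simp_all add: fps_mult_nth[of P] sum.atLeast_Suc_atMost numeral_eq_Suc)
qed

text \<open>The shift by k \<open>\<Omega>\<close> cancels the constant term of k f3, so
  \<open>w\<close> alone is left at order 0. The term 2 a_1 m^2 in \<open>C 2\<close> comes from
  1/z^2 = 1 - 2(z-1) + ... The frequency \<open>w\<close> is arbitrary here, so that both orders can
  use the result.\<close>

lemma horizon_coeff_radial_C:
  fixes m w k :: complex
  assumes "(\<lambda>x. f1 (1 + x)) has_fps_expansion F1" "(\<lambda>x. f3 (1 + x)) has_fps_expansion F3"
    and "fps_nth F1 0 = 0" "fps_nth F3 0 = complex_of_real \<Omega>"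
  defines "C \<equiv> horizon_coeff (radial_C f1 f3 m (w + k * complex_of_real \<Omega>) k)"
  shows "C 0 = w\<^sup>2"
    and "C 1 = - (2 * w * k * fps_nth F3 1) - fps_nth F1 1 * (k\<^sup>2 + m\<^sup>2)"
    and "C 2 = k\<^sup>2 * (fps_nth F3 1)\<^sup>2 - 2 * w * k * fps_nth F3 2
      - fps_nth F1 2 * (k\<^sup>2 + m\<^sup>2) + 2 * fps_nth F1 1 * m\<^sup>2"
proof -
  have mult_2: "fps_nth (P * Q) 2
      = fps_nth P 0 * fps_nth Q 2 + fps_nth P 1 * fps_nth Q 1 + fps_nth P 2 * fps_nth Q 0"
    for P Q :: "complex fps"
    by (simp add: fps_mult_nth sum.atLeast_Suc_atMost numeral_2_eq_2)
  have inv: "inverse (1 + fps_X :: complex fps) = Abs_fps (\<lambda>n. (- 1) ^ n)"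
    using fps_inverse_fps_X_plus1 by (simp add: add.commute)
  show "C 0 = w\<^sup>2"
    and "C 1 = - (2 * w * k * fps_nth F3 1) - fps_nth F1 1 * (k\<^sup>2 + m\<^sup>2)"
    and "C 2 = k\<^sup>2 * (fps_nth F3 1)\<^sup>2 - 2 * w * k * fps_nth F3 2
      - fps_nth F1 2 * (k\<^sup>2 + m\<^sup>2) + 2 * fps_nth F1 1 * m\<^sup>2"
    unfolding C_def horizon_coeff_eq[OF radial_C_has_fps_expansion[OF assms(1,2)]] inv power2_eq_square
    by (simp_all add: mult_2 assms(3,4))
qed

section \<open>The determinants of order one and two\<close>

lemma horizon_exponent_pole_skipping:
  assumes "T > 0"
  shows "horizon_exponent T \<Omega> (pole_skipping_freq T n + k * complex_of_real \<Omega>) k = - of_nat n / 2"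
  using assms
  by (simp add: horizon_exponent_def corotating_freq_def pole_skipping_freq_def field_simps)

context
  fixes f1 f2 f3 :: "complex \<Rightarrow> complex" and F1 F2 F3 :: "complex fps"
    and m w :: complex and T \<Omega> :: real
  assumes expansions: "(\<lambda>x. f1 (1 + x)) has_fps_expansion F1"
      "(\<lambda>x. f2 (1 + x)) has_fps_expansion F2" "(\<lambda>x. f3 (1 + x)) has_fps_expansion F3"
    and horizon: "fps_nth F1 0 = 0" "fps_nth F2 0 = 0" "fps_nth F3 0 = complex_of_real \<Omega>"
    and temperature: "T > 0" "fps_nth F1 1 * fps_nth F2 1 = (complex_of_real (4 * pi * T))\<^sup>2"
    and w: "w = pole_skipping_freq T 1"
begin

lemmas horizon_coeff_radial =
  horizon_coeff_radial_A[OF expansions(1,2) horizon(1,2)]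
  horizon_coeff_radial_B[OF expansions(1,2) horizon(1,2)]
  horizon_coeff_radial_C[OF expansions(1,3) horizon(1,3)]

text \<open>Since w = -2 \<pi> i T, the square (4 \<pi> T)^2 equals -4 w^2; this eliminates the
  temperature in favour of \<open>w\<close>.\<close>

lemma leading_coeff: "fps_nth F1 1 * fps_nth F2 1 = - 4 * w\<^sup>2"
  unfolding temperature(2) by (simp add: w pole_skipping_freq_def power_mult_distrib)

lemma pole_skipping_det_1:
  "pole_skipping_det f1 f2 f3 m T \<Omega> 1 k
    = poly [:- 2 * w\<^sup>2 - fps_nth F1 1 * m\<^sup>2, - 2 * w * fps_nth F3 1, - fps_nth F1 1:] k"
proof -
  let ?A = "horizon_coeff (radial_A f1 f2)"
  let ?C = "horizon_coeff (radial_C f1 f3 m (w + k * complex_of_real \<Omega>) k)"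
  have A2: "?A 2 = - 4 * w\<^sup>2"
    by (simp only: horizon_coeff_radial leading_coeff)
  have "pole_skipping_det f1 f2 f3 m T \<Omega> 1 k
      = frobenius_entry f1 f2 f3 m T \<Omega> (pole_skipping_freq T 1 + k * complex_of_real \<Omega>) k 1 1"
    unfolding pole_skipping_det_def by (subst det_single) auto
  \<comment> \<open>At \<rho> = -1/2 the coefficient A_3 cancels: it enters with factor
    \<rho>(\<rho>-1) = 3/4 directly and with 3/2 \<rho> = -3/4 through B_2.\<close>
  also have "\<dots> = ?A 2 / 2 + ?C 1"
    unfolding frobenius_entry_def Let_def horizon_exponent_pole_skipping[OF temperature(1)]
    by (simp add: horizon_coeff_radial(4) w field_simps)
  finally show ?thesis
    by (simp add: A2 horizon_coeff_radial(7) algebra_simps power2_eq_square)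
qed

text \<open>At \<rho> = -1 the factor \<rho> + S - 1 vanishes for S = 2, so the second column is
  just (C_0, C_1) with C_0 = (2w)^2. The first column is A_3/2 + A_2 + C_1 and A_3 - A_2 + C_2,
  where A_2 = -4 w^2.\<close>

lemma pole_skipping_det_2:
  fixes k :: complex
  defines "A \<equiv> horizon_coeff (radial_A f1 f2)"
    and "C \<equiv> horizon_coeff (radial_C f1 f3 m (2 * w + k * complex_of_real \<Omega>) k)"
  shows "pole_skipping_det f1 f2 f3 m T \<Omega> 2 k
    = (A 3 / 2 - 4 * w\<^sup>2 + C 1) * C 1 - 4 * w\<^sup>2 * (A 3 + 4 * w\<^sup>2 + C 2)"
proof -
  have A2: "A 2 = - 4 * w\<^sup>2"
    unfolding A_def by (simp only: horizon_coeff_radial leading_coeff)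
  have C0: "C 0 = 4 * w\<^sup>2"
    unfolding C_def horizon_coeff_radial(6) by (simp add: power_mult_distrib)
  have freq: "pole_skipping_freq T 2 = 2 * w"
    by (simp add: w pole_skipping_freq_def)
  have entry: "frobenius_entry f1 f2 f3 m T \<Omega> (2 * w + k * complex_of_real \<Omega>) k K S
      = A (int K - int S + 3) * (of_nat S - 2) * (of_nat S - 3)
        + horizon_coeff (radial_B f1 f2) (int K - int S + 2) * (of_nat S - 2)
        + C (int K - int S + 1)" for K S
    using horizon_exponent_pole_skipping[OF temperature(1), of \<Omega> 2 k]
    by (simp add: frobenius_entry_def Let_def freq A_def C_def)
  show ?thesis
    unfolding pole_skipping_det_def det_mat_2 freq
    by (simp add: entry horizon_coeff_radial(4,5) A2 C0 flip: A_def)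
qed

text \<open>Both C_1 and C_2 are quadratic in \<open>k\<close>, so the cubic and quartic terms come
  from C_1^2 alone. Once \<open>a1\<close>, \<open>c1\<close> and b_1 are known, every coefficient
  is affine in \<open>a2\<close>, \<open>c2\<close> and b_2.\<close>

lemma pole_skipping_det_2_poly:
  defines "a1 \<equiv> fps_nth F1 1" and "a2 \<equiv> fps_nth F1 2"
    and "c1 \<equiv> fps_nth F3 1" and "c2 \<equiv> fps_nth F3 2"
    and "A3 \<equiv> fps_nth F1 1 * fps_nth F2 2 + fps_nth F1 2 * fps_nth F2 1"
  shows "pole_skipping_det f1 f2 f3 m T \<Omega> 2 k
    = poly [:a1\<^sup>2 * m ^ 4 - a1 * m\<^sup>2 * (A3 / 2 - 4 * w\<^sup>2)
              - 4 * w\<^sup>2 * (A3 + 4 * w\<^sup>2 - a2 * m\<^sup>2 + 2 * a1 * m\<^sup>2),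
            4 * w * c1 * (2 * a1 * m\<^sup>2 - (A3 / 2 - 4 * w\<^sup>2)) + 16 * w ^ 3 * c2,
            12 * w\<^sup>2 * c1\<^sup>2 + 2 * a1\<^sup>2 * m\<^sup>2 - a1 * (A3 / 2 - 4 * w\<^sup>2) + 4 * w\<^sup>2 * a2,
            8 * a1 * w * c1,
            a1\<^sup>2:] k"
  unfolding pole_skipping_det_2 horizon_coeff_radial(2,7,8) assms
  by (simp add: field_simps eval_nat_numeral)

end

section \<open>Solving for the Taylor coefficients\<close>

text \<open>In the equation for \<open>E12\<close> the mass term cancels and leaves a1 D = 2 w^2.
  The temperature relation then gives \<open>b1\<close>, and the linear coefficient of the
  determinant gives \<open>c1\<close>. The hypotheses keep the unsimplified shape of the Vieta
  quotients so that those can be plugged in directly.\<close>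

lemma first_order_reconstruction:
  fixes w m D a1 b1 c1 :: "'a :: field_char_0"
  assumes "w \<noteq> 0" "a1 \<noteq> 0" "D \<noteq> 0"
    and A2: "a1 * b1 = - 4 * w\<^sup>2"
    and E11: "E11 = - (- 2 * w * c1) / - a1"
    and E12: "E12 = (- 2 * w\<^sup>2 - a1 * m\<^sup>2) / - a1" "E12 = D + m\<^sup>2"
  shows "a1 = 2 * w\<^sup>2 / D" and "b1 = - 2 * D" and "c1 = - (E11 * w / D)"
proof -
  have "(D + m\<^sup>2) * a1 = 2 * w\<^sup>2 + a1 * m\<^sup>2"
    using E12 \<open>a1 \<noteq> 0\<close> by (simp add: field_simps)
  then have a1_D: "a1 * D = 2 * w\<^sup>2"
    by (simp add: algebra_simps)
  then show "a1 = 2 * w\<^sup>2 / D"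
    using \<open>D \<noteq> 0\<close> by (simp add: nonzero_eq_divide_eq)
  have "a1 * b1 = - 2 * (a1 * D)"
    unfolding A2 a1_D by simp
  then have "a1 * b1 = a1 * (- 2 * D)"
    by (simp only: mult_ac)
  then show "b1 = - 2 * D"
    using \<open>a1 \<noteq> 0\<close> mult_left_cancel by blast
  have "E11 * a1 = - 2 * w * c1"
    unfolding E11 using \<open>a1 \<noteq> 0\<close> by simp
  then have "2 * w * (c1 * D) = - (E11 * a1) * D"
    by simp
  also have "\<dots> = - E11 * (a1 * D)"
    by simp
  also have "\<dots> = 2 * w * (- (E11 * w))"
    unfolding a1_D by (simp add: power2_eq_square)
  finally have "c1 * D = - (E11 * w)"
    using \<open>w \<noteq> 0\<close> by (subst (asm) mult_left_cancel) auto
  then show "c1 = - (E11 * w / D)"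
    using \<open>D \<noteq> 0\<close> by (metis minus_divide_left nonzero_eq_divide_eq)
qed

text \<open>Here \<open>e\<close> stands for E_1(k). The equations for \<open>E22\<close> and
  \<open>E24\<close> form a linear system in \<open>a2\<close> and \<open>b2\<close> with
  determinant -2 D^3 / w^2, nonzero by assumption; \<open>c2\<close> occurs only in
  \<open>E23\<close>, with coefficient -4 D^2 / w. The factors 2 in the conclusion turn Taylor
  coefficients into second derivatives.\<close>

lemma second_order_reconstruction:
  fixes w m e D a1 a2 b1 b2 c1 c2 :: "'a :: field_char_0"
  assumes "w \<noteq> 0" "D \<noteq> 0"
    and a1: "a1 = 2 * w\<^sup>2 / D" and b1: "b1 = - 2 * D" and c1: "c1 = - (e * w / D)"
    and A3: "A3 = a1 * b2 + a2 * b1"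
    and E22: "E22 = (12 * w\<^sup>2 * c1\<^sup>2 + 2 * a1\<^sup>2 * m\<^sup>2 - a1 * (A3 / 2 - 4 * w\<^sup>2) + 4 * w\<^sup>2 * a2) / a1\<^sup>2"
    and E23: "E23 = - (4 * w * c1 * (2 * a1 * m\<^sup>2 - (A3 / 2 - 4 * w\<^sup>2)) + 16 * w ^ 3 * c2) / a1\<^sup>2"
    and E24: "E24 = (a1\<^sup>2 * m ^ 4 - a1 * m\<^sup>2 * (A3 / 2 - 4 * w\<^sup>2)
              - 4 * w\<^sup>2 * (A3 + 4 * w\<^sup>2 - a2 * m\<^sup>2 + 2 * a1 * m\<^sup>2)) / a1\<^sup>2"
    and E12: "E12 = D + m\<^sup>2"
  shows "2 * a2 = - (w\<^sup>2 / (2 * D ^ 3)) * (m ^ 4 + (3 * E22 - 9 * e\<^sup>2 - 12 * E12) * m\<^sup>2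
            + 12 * E12\<^sup>2 + 12 * e\<^sup>2 * E12 - 4 * E12 * E22 + E24)" (is ?a)
    and "2 * b2 = - (1 / (2 * D)) * (3 * m ^ 4 + (E22 - 3 * e\<^sup>2 - 20 * E12) * m\<^sup>2
            + 3 * E24 + 12 * e\<^sup>2 * E12 + 20 * E12\<^sup>2 - 4 * E12 * E22)" (is ?b)
    and "2 * c2 = w / (4 * D ^ 3) * ((3 * e ^ 3 - 12 * e * E12 - e * E22 + 2 * E23) * m\<^sup>2
            + e * m ^ 4 + 12 * e * E12\<^sup>2 - 2 * E12 * E23 + e * E24)" (is ?c)
proof -
  have E22': "E22 = 3 * e\<^sup>2 + 2 * m\<^sup>2 + 2 * D - b2 / 2 + 3 * a2 * D\<^sup>2 / (2 * w\<^sup>2)"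
    using assms(1,2) unfolding E22 A3 a1 b1 c1 by (simp add: field_simps eval_nat_numeral)
  have E23': "E23 = 4 * e * m\<^sup>2 - e * b2 + e * a2 * D\<^sup>2 / w\<^sup>2 + 4 * e * D - 4 * c2 * D\<^sup>2 / w"
    using assms(1,2) unfolding E23 A3 a1 b1 c1 by (simp add: field_simps eval_nat_numeral)
  have E24': "E24 = m ^ 4 + 3 * a2 * D\<^sup>2 * m\<^sup>2 / (2 * w\<^sup>2) - m\<^sup>2 * b2 / 2 - 2 * D * m\<^sup>2 - 2 * D * b2
      + 2 * a2 * D ^ 3 / w\<^sup>2 - 4 * D\<^sup>2"
    using assms(1,2) unfolding E24 A3 a1 b1 c1 by (simp add: field_simps eval_nat_numeral)
  \<comment> \<open>The solution is verified, not derived: after substitution of the data each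
    formula is a rational identity in the unknowns, with denominators powers of \<open>D\<close> and
    \<open>w\<close>.\<close>
  show ?a
    using assms(1,2) unfolding E22' E24' E12 by (simp add: field_simps eval_nat_numeral)
  show ?b
    using assms(1,2) unfolding E22' E24' E12 by (simp add: field_simps eval_nat_numeral)
  show ?c
    using assms(1,2) unfolding E22' E23' E24' E12 by (simp add: field_simps eval_nat_numeral)
qed

section \<open>Horizon derivatives from the pole-skipping data\<close>

theorem mainTheorem2:
  fixes f1 f2 f3 :: "complex \<Rightarrow> complex"
    and m w :: complex
    and T \<Omega> :: real
    and E :: "nat \<Rightarrow> nat \<Rightarrow> complex"
  assumes metric: "metric_function f1" "metric_function f2" "metric_function f3"
    and horizon: "f1 1 = 0" "f2 1 = 0" "f3 1 = complex_of_real \<Omega>"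
    and temperature: "T > 0" "deriv f1 1 * deriv f2 1 = (complex_of_real (4 * pi * T))\<^sup>2"
    and mass: "m\<^sup>2 \<in> \<real>"
    and w: "w = pole_skipping_freq T 1"
    and E: "\<And>n l. E n l = pole_skipping_data f1 f2 f3 m T \<Omega> n l"
    and nondeg: "E 1 2 - m\<^sup>2 \<noteq> 0"
  shows
    "deriv f1 1 = 2 * w\<^sup>2 / (E 1 2 - m\<^sup>2)
   \<and> deriv f2 1 = 2 * (m\<^sup>2 - E 1 2)
   \<and> deriv f3 1 = E 1 1 * w / (m\<^sup>2 - E 1 2)
   \<and> (deriv ^^ 2) f1 1 =
       - (w\<^sup>2 / (2 * (E 1 2 - m\<^sup>2) ^ 3))
         * (m ^ 4
            + (3 * E 2 2 - 9 * (E 1 1)\<^sup>2 - 12 * E 1 2) * m\<^sup>2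
            + 12 * (E 1 2)\<^sup>2 + 12 * (E 1 1)\<^sup>2 * E 1 2
            - 4 * E 1 2 * E 2 2 + E 2 4)
   \<and> (deriv ^^ 2) f2 1 =
       - (1 / (2 * (E 1 2 - m\<^sup>2)))
         * (3 * m ^ 4
            + (E 2 2 - 3 * (E 1 1)\<^sup>2 - 20 * E 1 2) * m\<^sup>2
            + 3 * E 2 4 + 12 * (E 1 1)\<^sup>2 * E 1 2
            + 20 * (E 1 2)\<^sup>2 - 4 * E 1 2 * E 2 2)
   \<and> (deriv ^^ 2) f3 1 =
       w / (4 * (E 1 2 - m\<^sup>2) ^ 3)
         * ((3 * (E 1 1) ^ 3 - 12 * E 1 1 * E 1 2 - E 1 1 * E 2 2 + 2 * E 2 3) * m\<^sup>2
            + E 1 1 * m ^ 4 + 12 * E 1 1 * (E 1 2)\<^sup>2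
            - 2 * E 1 2 * E 2 3 + E 1 1 * E 2 4)"
proof -
  define F1 F2 F3 where F: "F1 = fps_expansion f1 1" "F2 = fps_expansion f2 1" "F3 = fps_expansion f3 1"
  note expansions = metric[THEN metric_function_has_fps_expansion, folded F]
  have F0: "fps_nth F1 0 = 0" "fps_nth F2 0 = 0" "fps_nth F3 0 = complex_of_real \<Omega>"
    using horizon by (simp_all add: F fps_expansion_def)
  have deriv_eq: "deriv f1 1 = fps_nth F1 1" "deriv f2 1 = fps_nth F2 1" "deriv f3 1 = fps_nth F3 1"
    by (simp_all add: F fps_expansion_def)
  have deriv2_eq: "(deriv ^^ 2) f1 1 = 2 * fps_nth F1 2" "(deriv ^^ 2) f2 1 = 2 * fps_nth F2 2"
    "(deriv ^^ 2) f3 1 = 2 * fps_nth F3 2"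
    by (simp_all add: F fps_expansion_def)
  note context_assms = expansions F0 temperature(1) temperature(2)[unfolded deriv_eq] w
  have "w \<noteq> 0"
    using \<open>T > 0\<close> by (simp add: w pole_skipping_freq_def)
  have A2: "fps_nth F1 1 * fps_nth F2 1 = - 4 * w\<^sup>2"
    by (rule leading_coeff[OF context_assms])
  then have a1: "fps_nth F1 1 \<noteq> 0"
    using \<open>w \<noteq> 0\<close> by auto
  define D where "D = E 1 2 - m\<^sup>2"
  have "D \<noteq> 0" and E12: "E 1 2 = D + m\<^sup>2"
    using nondeg by (simp_all add: D_def)
  \<comment> \<open>These are the leading coefficients of the two determinants; being nonzero, they
    fix the degrees as 2 and 4, as Vieta's formulas require.\<close>
  have "- fps_nth F1 1 \<noteq> 0" "(fps_nth F1 1)\<^sup>2 \<noteq> 0"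
    using a1 by simp_all
  note E1 = pole_skipping_data_quadratic[OF pole_skipping_det_1[OF context_assms, of m] this(1),
      folded E]
    and E2 = pole_skipping_data_quartic[OF pole_skipping_det_2_poly[OF context_assms, of m] this(2),
      folded E]
  note first = first_order_reconstruction[OF \<open>w \<noteq> 0\<close> a1 \<open>D \<noteq> 0\<close> A2 E1 E12]
  \<comment> \<open>The first-order values enter as premises, and \<open>refl\<close> instantiates
    \<open>A3\<close> with its expression in the Taylor coefficients.\<close>
  note second = second_order_reconstruction[OF \<open>w \<noteq> 0\<close> \<open>D \<noteq> 0\<close> first refl E2 E12]
  have minus_D: "m\<^sup>2 - E 1 2 = - D"
    by (simp add: D_def)
  show ?thesis
    unfolding deriv_eq deriv2_eq minus_D D_def[symmetric]
    by (intro conjI second) (simp_all only: first, simp_all)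
qed

end
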